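(* Let $K \subseteq \mathbb{R}^n$ be a nonempty compact connected set satisfying the following geometric condition: there exist constants $\epsilon_K > 0$, $\eta_K > 0$ and $N \geq n$ such that, for all $x \in K$ and all $0 < \delta \leq \epsilon_K$, $$\mathrm{vol}\left(K \cap B^n_\delta(x)\right) \geq \eta_K\, \delta^N\, \mathrm{vol}(B^n).$$ Let $f \in \mathbb{R}[x]$ be an $n$-variate polynomial. Then $$f^{(r)} - f_{\min} = O\left(\frac{\log^2 r}{r^2}\right) \quad \text{as } r \to \infty.$$
   Context: Here $\mathrm{vol}$ is Lebesgue measure, $B^n_\delta(x)$ is the Euclidean ball in $\mathbb{R}^n$ centered at $x$ with radius $\delta$, and $B^n = B^n_1(0)$. Set $f_{\min} = \min_{x \in K} f(x)$. Let $\lambda$ be the Lebesgue measure on $K$. Let $\Sigma[x]_r$ denote the set of $n$-variate real polynomials of degree at most $2r$ that can be written as a sum of squares of real polynomials. For $r \in \mathbb{N}$ define $$f^{(r)} := \min\left\{ \int_K f(x)\, \sigma(x)\, d\lambda(x) \;:\; \sigma \in \Sigma[x]_r,\ \int_K \sigma(x)\, d\lambda(x) = 1 \right\}.$$ The notation $\log^2 r$ means $(\log r)^2$, and the constant implied by $O(\cdot)$ may depend on $K$ and $f$ but not on $r$. *)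

theory Defs
  imports
    "HOL-Analysis.Analysis"
    "HOL-Library.Poly_Mapping"
    "HOL-Library.Landau_Symbols"
begin

text \<open>
  Real polynomials in variables indexed by the finite type \<open>'n\<close>: finitely supported maps from
  exponent vectors to coefficients, with the (convolution) ring structure of
  \<^theory>\<open>HOL-Library.Poly_Mapping\<close>.
\<close>

type_synonym 'n rpoly = "('n \<Rightarrow>\<^sub>0 nat) \<Rightarrow>\<^sub>0 real"

definition peval :: "'n::finite rpoly \<Rightarrow> real ^ 'n \<Rightarrow> real" where
  "peval p x =
    (\<Sum>m\<in>Poly_Mapping.keys p.
      Poly_Mapping.lookup p m * (\<Prod>i\<in>UNIV. (x $ i) ^ Poly_Mapping.lookup m i))"

text \<open>The zero polynomial gets total degree 0.\<close>

definition total_degree :: "'n::finite rpoly \<Rightarrow> nat" where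
  "total_degree p =
    Max (insert 0 ((\<lambda>m. \<Sum>i\<in>UNIV. Poly_Mapping.lookup m i) ` Poly_Mapping.keys p))"

definition sos_polys :: "nat \<Rightarrow> 'n::finite rpoly set" where
  "sos_polys r = {\<sigma>. total_degree \<sigma> \<le> 2 * r \<and> (\<exists>qs. \<sigma> = (\<Sum>q\<leftarrow>qs. q ^ 2))}"

text \<open>
  Both minima are taken literally, as least elements of the respective sets of reals; on the reals
  \<open>LEAST\<close> is unspecified unless the minimum is attained.
\<close>

definition min_value :: "(real ^ 'n) set \<Rightarrow> 'n::finite rpoly \<Rightarrow> real" where
  "min_value K f = (LEAST v. \<exists>x\<in>K. v = peval f x)"

definition upper_bound :: "(real ^ 'n) set \<Rightarrow> 'n::finite rpoly \<Rightarrow> nat \<Rightarrow> real" where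
  "upper_bound K f r =
    (LEAST v. \<exists>\<sigma>\<in>sos_polys r.
       (\<integral>x. peval \<sigma> x \<partial>lebesgue_on K) = 1 \<and>
       v = (\<integral>x. peval f x * peval \<sigma> x \<partial>lebesgue_on K))"

end

theory Submission
  imports Defs
begin

text \<open>
  Let \<open>g = f - f_min\<close>, with \<open>0 \<le> g \<le> W\<close> on \<open>K\<close>, and let \<open>x0\<close> be a minimizer. For the Chebyshev
  polynomial \<open>T\<close> of degree \<open>s \<approx> r / deg f\<close>, test \<open>f\<^sup>(\<^sup>r\<^sup>)\<close> with \<open>\<sigma> = (T (1 + a\<^sup>2 - g / W))\<^sup>2\<close>. Where
  \<open>g > a\<^sup>2 W\<close> this is at most 1, while on a ball around \<open>x0\<close> of radius proportional to \<open>a\<^sup>2\<close> (\<open>f\<close> is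
  Lipschitz on \<open>K\<close>) it is at least \<open>(1 + a)\<^bsup>2s\<^esup> / 4\<close>; that ball meets \<open>K\<close> in volume at least a
  multiple of \<open>a\<^bsup>2N\<^esup>\<close>. Hence \<open>f\<^sup>(\<^sup>r\<^sup>) - f_min \<le> a\<^sup>2 W + C / (a\<^bsup>2N\<^esup> (1 + a)\<^bsup>2s\<^esup>)\<close>, and \<open>a = c ln r / r\<close> with
  \<open>c\<close> large makes the second term \<open>O(1 / r\<^sup>2)\<close>.

  Since \<open>f\<^sup>(\<^sup>r\<^sup>)\<close> is a literal minimum, it must also be shown to be attained: it is the minimum of
  \<open>\<integral> f q\<^sup>2\<close> over the \<open>L\<^sup>2(K)\<close>-unit sphere of the finite-dimensional space of polynomial functions of
  degree at most \<open>r\<close>.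
\<close>

section \<open>Polynomial functions\<close>

definition monomial_at :: "('n::finite \<Rightarrow>\<^sub>0 nat) \<Rightarrow> real ^ 'n \<Rightarrow> real" where
  "monomial_at m x = (\<Prod>i\<in>UNIV. (x $ i) ^ Poly_Mapping.lookup m i)"

definition monomial_degree :: "('n::finite \<Rightarrow>\<^sub>0 nat) \<Rightarrow> nat" where
  "monomial_degree m = (\<Sum>i\<in>UNIV. Poly_Mapping.lookup m i)"

lemma peval_eq_sum:
  assumes "finite A" "Poly_Mapping.keys p \<subseteq> A"
  shows "peval p x = (\<Sum>m\<in>A. Poly_Mapping.lookup p m * monomial_at m x)"
  unfolding peval_def monomial_at_def
  by (rule sum.mono_neutral_left) (use assms in \<open>auto simp: in_keys_iff\<close>)

lemma peval_0 [simp]: "peval 0 x = 0"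
  by (simp add: peval_def)

lemma peval_add: "peval (p + q) x = peval p x + peval q x"
proof -
  let ?A = "Poly_Mapping.keys p \<union> Poly_Mapping.keys q"
  have "peval (p + q) x = (\<Sum>m\<in>?A. Poly_Mapping.lookup (p + q) m * monomial_at m x)"
    by (rule peval_eq_sum) (auto simp: Poly_Mapping.keys_add)
  then show ?thesis
    by (simp add: peval_eq_sum[of ?A p] peval_eq_sum[of ?A q] lookup_add distrib_right sum.distrib)
qed

lemma peval_sum: "peval (\<Sum>i\<in>A. p i) x = (\<Sum>i\<in>A. peval (p i) x)"
  by (induction A rule: infinite_finite_induct) (simp_all add: peval_add)

lemma peval_sum_list: "peval (\<Sum>i\<leftarrow>xs. p i) x = (\<Sum>i\<leftarrow>xs. peval (p i) x)"
  by (induction xs) (simp_all add: peval_add)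

lemma peval_single: "peval (Poly_Mapping.single m c) x = c * monomial_at m x"
  by (subst peval_eq_sum[of "{m}"]) auto

lemma poly_mapping_eq_sum_single:
  "p = (\<Sum>m\<in>Poly_Mapping.keys p. Poly_Mapping.single m (Poly_Mapping.lookup p m))"
  by (rule poly_mapping_eqI)
    (auto simp: lookup_sum lookup_single when_def in_keys_iff sum.delta')

lemma monomial_at_add: "monomial_at (m + n) x = monomial_at m x * monomial_at n x"
  by (simp add: monomial_at_def lookup_add power_add prod.distrib)

lemma monomial_degree_add: "monomial_degree (m + n) = monomial_degree m + monomial_degree n"
  by (simp add: monomial_degree_def lookup_add sum.distrib)

lemma peval_mult: "peval (p * q) x = peval p x * peval q x"
proof -
  have "p * q = (\<Sum>m\<in>Poly_Mapping.keys p. \<Sum>n\<in>Poly_Mapping.keys q.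
      Poly_Mapping.single (m + n) (Poly_Mapping.lookup p m * Poly_Mapping.lookup q n))"
    by (subst poly_mapping_eq_sum_single[of p], subst poly_mapping_eq_sum_single[of q])
      (simp add: sum_product mult_single)
  then have "peval (p * q) x = (\<Sum>m\<in>Poly_Mapping.keys p. \<Sum>n\<in>Poly_Mapping.keys q.
      (Poly_Mapping.lookup p m * monomial_at m x) * (Poly_Mapping.lookup q n * monomial_at n x))"
    by (simp add: peval_sum peval_single monomial_at_add algebra_simps)
  then show ?thesis
    by (simp add: peval_eq_sum[OF finite_keys subset_refl] sum_product)
qed

lemma peval_power: "peval (p ^ k) x = peval p x ^ k"
proof (induction k)
  case 0
  have "peval (1 :: 'a rpoly) x = 1"
    by (subst single_one[symmetric], subst peval_single) (simp add: monomial_at_def)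
  then show ?case by simp
qed (simp add: peval_mult)

section \<open>Total degree and the spaces of polynomial functions of bounded degree\<close>

lemma total_degree_le_iff:
  "total_degree p \<le> r \<longleftrightarrow> (\<forall>m\<in>Poly_Mapping.keys p. monomial_degree m \<le> r)"
  unfolding total_degree_def monomial_degree_def by (subst Max_le_iff) auto

lemma total_degree_add_le:
  assumes "total_degree p \<le> r" "total_degree q \<le> r"
  shows "total_degree (p + q) \<le> r"
  using assms Poly_Mapping.keys_add[of p q] unfolding total_degree_le_iff by blast

lemma total_degree_mult_le:
  assumes "total_degree p \<le> r" "total_degree q \<le> s"
  shows "total_degree (p * q) \<le> r + s"
  using assms keys_mult[of p q] unfolding total_degree_le_iff
  by (fastforce simp: monomial_degree_add intro: add_mono)

text \<open>The degree is a condition on one representative, not on every polynomial with the same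
  values.\<close>

definition poly_funs :: "nat \<Rightarrow> (real ^ 'n::finite \<Rightarrow> real) set" where
  "poly_funs r = {peval p | p. total_degree p \<le> r}"

lemma poly_funs_peval: "total_degree p \<le> r \<Longrightarrow> peval p \<in> poly_funs r"
  by (auto simp: poly_funs_def)

lemma poly_funs_add:
  assumes "g \<in> poly_funs r" "h \<in> poly_funs r"
  shows "(\<lambda>x. g x + h x) \<in> poly_funs r"
proof -
  obtain p q where "g = peval p" "total_degree p \<le> r" "h = peval q" "total_degree q \<le> r"
    using assms by (auto simp: poly_funs_def)
  then show ?thesis
    using poly_funs_peval[OF total_degree_add_le, of p r q] by (simp add: peval_add[abs_def])
qed

lemma poly_funs_mult:
  assumes "g \<in> poly_funs r" "h \<in> poly_funs s"
  shows "(\<lambda>x. g x * h x) \<in> poly_funs (r + s)"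
proof -
  obtain p q where "g = peval p" "total_degree p \<le> r" "h = peval q" "total_degree q \<le> s"
    using assms by (auto simp: poly_funs_def)
  then show ?thesis
    using poly_funs_peval[OF total_degree_mult_le, of p r q s] by (simp add: peval_mult[abs_def])
qed

lemma poly_funs_monomial:
  assumes "monomial_degree m \<le> r"
  shows "monomial_at m \<in> poly_funs r"
proof -
  have "total_degree (Poly_Mapping.single m (1::real)) \<le> r"
    using assms by (simp add: total_degree_le_iff)
  moreover have "peval (Poly_Mapping.single m 1) = monomial_at m"
    by (simp add: fun_eq_iff peval_single)
  ultimately show ?thesis
    by (metis poly_funs_peval)
qed

lemma poly_funs_const: "(\<lambda>x :: real ^ 'n::finite. c) \<in> poly_funs r"
proof -
  have "total_degree (Poly_Mapping.single (0 :: 'n \<Rightarrow>\<^sub>0 nat) c) \<le> r"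
    by (simp add: total_degree_le_iff monomial_degree_def)
  moreover have "peval (Poly_Mapping.single (0 :: 'n \<Rightarrow>\<^sub>0 nat) c) = (\<lambda>x. c)"
    by (simp add: fun_eq_iff peval_single monomial_at_def)
  ultimately show ?thesis
    by (metis poly_funs_peval)
qed

lemma poly_funs_cmult: "g \<in> poly_funs r \<Longrightarrow> (\<lambda>x. c * g x) \<in> poly_funs r"
  using poly_funs_mult[OF poly_funs_const[of c 0]] by simp

lemma poly_funs_mono: "r \<le> s \<Longrightarrow> poly_funs r \<subseteq> poly_funs s"
  by (auto simp: poly_funs_def)

lemma poly_funs_sum:
  "(\<And>i. i \<in> A \<Longrightarrow> g i \<in> poly_funs r) \<Longrightarrow> (\<lambda>x. \<Sum>i\<in>A. g i x) \<in> poly_funs r"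
  by (induction A rule: infinite_finite_induct)
    (simp_all add: poly_funs_const poly_funs_add)

text \<open>Each single exponent is bounded by the degree, so the exponent functions lie in a finite
  product of intervals.\<close>

lemma finite_monomial_degree_le: "finite {m :: 'n::finite \<Rightarrow>\<^sub>0 nat. monomial_degree m \<le> r}"
proof -
  have "Poly_Mapping.lookup m i \<le> r" if "monomial_degree m \<le> r" for m :: "'n \<Rightarrow>\<^sub>0 nat" and i
    using member_le_sum[of i UNIV "Poly_Mapping.lookup m"] that by (simp add: monomial_degree_def)
  then have "Poly_Mapping.lookup ` {m :: 'n \<Rightarrow>\<^sub>0 nat. monomial_degree m \<le> r} \<subseteq> PiE UNIV (\<lambda>_. {..r})"
    by auto
  then have "finite (Poly_Mapping.lookup ` {m :: 'n \<Rightarrow>\<^sub>0 nat. monomial_degree m \<le> r})"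
    by (rule finite_subset) (simp add: finite_PiE)
  then show ?thesis
    by (rule finite_imageD) (simp add: inj_on_def lookup_inject)
qed

lemma poly_funs_eq_sum_monomials:
  assumes "g \<in> poly_funs r"
  obtains c where "g = (\<lambda>x. \<Sum>m | monomial_degree m \<le> r. c m * monomial_at m x)"
proof -
  obtain p where "g = peval p" "total_degree p \<le> r"
    using assms by (auto simp: poly_funs_def)
  then show thesis
    using that[of "Poly_Mapping.lookup p"] finite_monomial_degree_le[of r]
    by (auto simp: fun_eq_iff total_degree_le_iff intro!: peval_eq_sum)
qed

lemma continuous_on_peval: "continuous_on S (peval p)"
  unfolding peval_def by (intro continuous_intros)

lemma continuous_on_poly_funs: "g \<in> poly_funs r \<Longrightarrow> continuous_on S g"
  by (auto simp: poly_funs_def continuous_on_peval)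

text \<open>
  A summand \<open>q\<close> of a sum of squares of degree at most \<open>2r\<close> has degree at most \<open>r\<close>. This is reduced
  to one variable by restricting to rays through the origin. As only the values of \<open>q\<close> matter,
  it suffices to bound its degree along all rays, which avoids the identity theorem for polynomials
  in several variables.
\<close>

definition ray_poly :: "'n::finite rpoly \<Rightarrow> real ^ 'n \<Rightarrow> real poly" where
  "ray_poly p x = (\<Sum>m\<in>Poly_Mapping.keys p.
     monom (Poly_Mapping.lookup p m * monomial_at m x) (monomial_degree m))"

lemma poly_ray_poly: "poly (ray_poly p x) t = peval p (t *\<^sub>R x)"
  unfolding ray_poly_def peval_eq_sum[OF finite_keys subset_refl]
  by (simp add: poly_sum poly_monom monomial_at_def monomial_degree_def power_mult_distrib
      prod.distrib power_sum algebra_simps)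

lemma degree_ray_poly_le: "degree (ray_poly p x) \<le> total_degree p"
  unfolding ray_poly_def
  by (rule degree_sum_le) (use total_degree_le_iff[of p "total_degree p"] in \<open>auto intro: order_trans[OF degree_monom_le]\<close>)

text \<open>The coefficient of t^k in \<open>ray_poly p x\<close> is the value at \<open>x\<close>
  of the homogeneous part of \<open>p\<close> of degree k. If these vanish for all k > r, discarding
  the terms of degree above \<open>r\<close> does not change the function.\<close>

lemma peval_in_poly_funs_if_ray:
  assumes "\<And>x. degree (ray_poly p x) \<le> r"
  shows "peval p \<in> poly_funs r"
proof -
  let ?c = "\<lambda>m. if monomial_degree m \<le> r then Poly_Mapping.lookup p m else 0"
  have "peval p x = (\<Sum>m\<in>Poly_Mapping.keys p. ?c m * monomial_at m x)" for x
  proof -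
    have "peval p x = poly (ray_poly p x) 1"
      by (simp add: poly_ray_poly)
    also have "\<dots> = (\<Sum>k\<le>r. coeff (ray_poly p x) k)"
      using assms[of x] by (auto simp: poly_altdef intro!: sum.mono_neutral_left le_degree)
    also have "\<dots> = (\<Sum>k\<le>r. \<Sum>m\<in>Poly_Mapping.keys p.
        if monomial_degree m = k then Poly_Mapping.lookup p m * monomial_at m x else 0)"
      by (simp add: ray_poly_def coeff_sum)
    also have "\<dots> = (\<Sum>m\<in>Poly_Mapping.keys p. ?c m * monomial_at m x)"
      by (subst sum.swap, rule sum.cong) (auto simp: sum.delta)
    finally show ?thesis .
  qed
  then have "peval p = (\<lambda>x. \<Sum>m\<in>Poly_Mapping.keys p. ?c m * monomial_at m x)"
    by blast
  moreover have "(\<lambda>x. ?c m * monomial_at m x) \<in> poly_funs r" for m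
    using poly_funs_cmult[OF poly_funs_monomial, of m r "?c m"] poly_funs_const[of 0 r] by auto
  ultimately show ?thesis
    by (simp only: poly_funs_sum)
qed

text \<open>Top coefficients of squares cannot cancel over the reals: with \<open>d\<close> the
  largest degree that occurs, the coefficient of the sum at 2d is a sum of squares, one of them
  nonzero.\<close>

lemma degree_le_of_degree_sum_squares_le:
  fixes ps :: "real poly list"
  assumes "degree (\<Sum>p\<leftarrow>ps. p\<^sup>2) \<le> 2 * r" and "p \<in> set ps"
  shows "degree p \<le> r"
proof (rule ccontr)
  assume "\<not> degree p \<le> r"
  define d where "d = Max (degree ` set ps)"
  have le: "degree q \<le> d" if "q \<in> set ps" for q
    using that by (simp add: d_def)
  have "d > r"
    using le[OF assms(2)] \<open>\<not> degree p \<le> r\<close> by simp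
  have "d \<in> degree ` set ps"
    unfolding d_def using assms(2) by (intro Max_in) auto
  then obtain p0 where p0: "p0 \<in> set ps" "degree p0 = d"
    by auto
  \<comment> \<open>In the convolution only i = d survives: any other index puts one factor above
    degree \<open>d\<close>.\<close>
  have coeff_sq: "coeff (q\<^sup>2) (2 * d) = (coeff q d)\<^sup>2" if "degree q \<le> d" for q :: "real poly"
  proof -
    have "coeff (q * q) (d + d) = (\<Sum>i\<le>d + d. if i = d then coeff q d * coeff q d else 0)"
      unfolding coeff_mult
    proof (rule sum.cong[OF refl])
      fix i assume "i \<in> {..d + d}"
      then show "coeff q i * coeff q (d + d - i) = (if i = d then coeff q d * coeff q d else 0)"
        using that by (cases i d rule: linorder_cases) (auto simp: coeff_eq_0)
    qed
    then show ?thesis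
      by (simp add: power2_eq_square mult_2)
  qed
  have "coeff (\<Sum>p\<leftarrow>ps. p\<^sup>2) (2 * d) = (\<Sum>p\<leftarrow>ps. coeff (p\<^sup>2) (2 * d))"
    by (induction ps) auto
  also have "\<dots> = (\<Sum>p\<leftarrow>ps. (coeff p d)\<^sup>2)"
    using le by (intro arg_cong[of _ _ sum_list] map_cong refl coeff_sq)
  also have "\<dots> \<ge> (coeff p0 d)\<^sup>2"
    using p0 by (intro member_le_sum_list) auto
  \<comment> \<open>Since d > r >= 0, \<open>p0\<close> is not the zero polynomial, so its
    coefficient at \<open>d\<close> is a genuine leading coefficient.\<close>
  moreover have "coeff p0 d \<noteq> 0"
    using p0 \<open>d > r\<close> by (metis leading_coeff_0_iff degree_0 not_less_zero)
  ultimately have "coeff (\<Sum>p\<leftarrow>ps. p\<^sup>2) (2 * d) > 0"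
    by (smt (verit) zero_less_power2)
  moreover have "coeff (\<Sum>p\<leftarrow>ps. p\<^sup>2) (2 * d) = 0"
    using assms(1) \<open>d > r\<close> by (intro coeff_eq_0) simp
  ultimately show False by simp
qed

text \<open>On each ray the squares of the \<open>ray_poly q x\<close> add up to the ray polynomial
  of the whole sum, as both agree at every t. Its degree is at most 2r, so the one-variable lemma
  applies.\<close>

lemma sos_summand_in_poly_funs:
  assumes "total_degree (\<Sum>q\<leftarrow>qs. q\<^sup>2) \<le> 2 * r" and "q \<in> set qs"
  shows "peval q \<in> poly_funs r"
proof (rule peval_in_poly_funs_if_ray)
  fix x
  let ?s = "\<Sum>q\<leftarrow>qs. q\<^sup>2"
  have "poly (\<Sum>p\<leftarrow>map (\<lambda>q. ray_poly q x) qs. p\<^sup>2) t = poly (ray_poly ?s x) t" for t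
    unfolding poly_ray_poly peval_sum_list
    by (induction qs) (simp_all add: peval_power poly_ray_poly)
  then have "(\<Sum>p\<leftarrow>map (\<lambda>q. ray_poly q x) qs. p\<^sup>2) = ray_poly ?s x"
    by (intro poly_eq_poly_eq_iff[THEN iffD1] ext)
  then show "degree (ray_poly q x) \<le> r"
    using degree_ray_poly_le[of ?s x] assms
      degree_le_of_degree_sum_squares_le[of "map (\<lambda>q. ray_poly q x) qs" r "ray_poly q x"]
    by simp
qed

section \<open>Attainment of the minimum of a quadratic form\<close>

text \<open>Gram--Schmidt in \<open>L\<^sup>2(M)\<close> without taking quotients: functions vanishing almost everywhere are
  dropped, so no linear independence of \<open>G\<close> is needed.\<close>

lemma orthonormal_exists:
  fixes V :: "('a \<Rightarrow> real) set"
  assumes add: "\<And>g h. g \<in> V \<Longrightarrow> h \<in> V \<Longrightarrow> (\<lambda>x. g x + h x) \<in> V"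
    and cmult: "\<And>c g. g \<in> V \<Longrightarrow> (\<lambda>x. c * g x) \<in> V"
    and zero: "(\<lambda>x. 0) \<in> V"
    and int: "\<And>g h. g \<in> V \<Longrightarrow> h \<in> V \<Longrightarrow> integrable M (\<lambda>x. g x * h x)"
    and "finite G" "G \<subseteq> V"
  shows "\<exists>k::nat. \<exists>e. (\<forall>i<k. e i \<in> V) \<and>
           (\<forall>i<k. \<forall>j<k. (\<integral>x. e i x * e j x \<partial>M) = (if i = j then 1 else 0)) \<and>
           (\<forall>g\<in>G. \<exists>c. AE x in M. g x = (\<Sum>i<k. c i * e i x))"
  using \<open>finite G\<close> \<open>G \<subseteq> V\<close>
proof (induction G rule: finite_induct)
  case empty
  show ?case by (rule exI[of _ 0]) auto
next
  case (insert g G)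
  then obtain k :: nat and e where IH: "\<forall>i<k. e i \<in> V"
    "\<forall>i<k. \<forall>j<k. (\<integral>x. e i x * e j x \<partial>M) = (if i = j then 1 else 0)"
    "\<forall>g\<in>G. \<exists>c. AE x in M. g x = (\<Sum>i<k. c i * e i x)"
    by auto
  note eV = IH(1)[rule_format] and orth = IH(2)[rule_format] and span = IH(3)[rule_format]
  have sumV: "(\<lambda>x. \<Sum>i\<in>A. c i * e i x) \<in> V" if "A \<subseteq> {..<k}" for c and A :: "nat set"
  proof -
    have "finite A" using that finite_subset by blast
    then show ?thesis using that
      by (induction A rule: finite_induct) (auto intro!: zero add cmult eV)
  qed
  \<comment> \<open>\<open>h\<close> is the residual of \<open>g\<close> after removing its
    projection onto the functions \<open>e i\<close> found so far.\<close>
  define p where "p i = (\<integral>x. g x * e i x \<partial>M)" for i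
  define h where "h x = g x + (\<Sum>i<k. - p i * e i x)" for x
  have hV: "h \<in> V"
    unfolding h_def[abs_def] using insert.prems by (intro add sumV) auto
  have h_orth: "(\<integral>x. h x * e j x \<partial>M) = 0" if "j < k" for j
  proof -
    have "(\<integral>x. h x * e j x \<partial>M) = (\<integral>x. g x * e j x + (\<Sum>i<k. - p i * (e i x * e j x)) \<partial>M)"
      unfolding h_def by (intro Bochner_Integration.integral_cong)
        (simp_all add: distrib_right sum_distrib_right mult.assoc)
    also have "\<dots> = p j + (\<integral>x. (\<Sum>i<k. - p i * (e i x * e j x)) \<partial>M)"
      unfolding p_def using insert.prems that
      by (intro Bochner_Integration.integral_add) (auto intro!: int eV simp del: sum_negf)
    also have "(\<integral>x. (\<Sum>i<k. - p i * (e i x * e j x)) \<partial>M) = (\<Sum>i<k. - p i * (\<integral>x. e i x * e j x \<partial>M))"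
      using that by (subst Bochner_Integration.integral_sum) (auto intro!: int eV simp del: sum_negf)
    also have "(\<Sum>i<k. - p i * (\<integral>x. e i x * e j x \<partial>M)) = (\<Sum>i<k. if i = j then - p i else 0)"
      using that by (intro sum.cong) (auto simp: orth)
    also have "\<dots> = - p j" using that by simp
    finally show ?thesis by simp
  qed
  have g_eq: "g x = h x + (\<Sum>i<k. p i * e i x)" for x
    by (simp add: h_def sum_negf)
  define n where "n = (\<integral>x. h x * h x \<partial>M)"
  have n0: "n \<ge> 0" unfolding n_def by simp
  show ?case
  proof (cases "n = 0")
    case True
    have "AE x in M. h x * h x = 0"
      using True unfolding n_def by (subst (asm) integral_nonneg_eq_0_iff_AE) (auto intro!: int hV)
    then have "AE x in M. g x = (\<Sum>i<k. p i * e i x)"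
      by eventually_elim (simp add: g_eq)
    then show ?thesis
      using eV orth span by (intro exI[of _ k] exI[of _ e]) auto
  next
    case False
    define e' where "e' = e(k := (\<lambda>x. 1 / sqrt n * h x))"
    have e': "e' i = e i" if "i < k" for i using that by (simp add: e'_def)
    have e'k: "e' k = (\<lambda>x. 1 / sqrt n * h x)" by (simp add: e'_def)
    have sum': "(\<Sum>i<Suc k. c i * e' i x) = (\<Sum>i<k. c i * e i x) + c k / sqrt n * h x" for c x
      by (simp add: e'k e')
    have "(\<integral>x. e' k x * e' k x \<partial>M) = (\<integral>x. 1 / n * (h x * h x) \<partial>M)"
      using n0 unfolding e'k by (intro Bochner_Integration.integral_cong) auto
    then have kk: "(\<integral>x. e' k x * e' k x \<partial>M) = 1"
      using False by (simp add: n_def)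
    have "(\<integral>x. e' k x * e' j x \<partial>M) = (\<integral>x. 1 / sqrt n * (h x * e j x) \<partial>M)" if "j < k" for j
      using that by (intro Bochner_Integration.integral_cong) (auto simp: e'k e')
    then have kj: "(\<integral>x. e' k x * e' j x \<partial>M) = 0" if "j < k" for j
      using that h_orth by simp
    have "(\<integral>x. e' i x * e' j x \<partial>M) = (if i = j then 1 else 0)" if "i < Suc k" "j < Suc k" for i j
      using that kk kj[of j] kj[of i] orth[of i j]
      by (cases "i = k"; cases "j = k") (auto simp: less_Suc_eq e' mult.commute)
    moreover have "e' i \<in> V" if "i < Suc k" for i
      using that eV cmult[OF hV, of "1 / sqrt n"] by (cases "i = k") (auto simp: e'k e')
    moreover have "\<exists>c. AE x in M. g' x = (\<Sum>i<Suc k. c i * e' i x)" if g': "g' \<in> insert g G" for g'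
    proof (cases "g' = g")
      case True
      \<comment> \<open>The weight \<open>sqrt n\<close> undoes the normalization of
        \<open>h\<close>.\<close>
      have "g x = (\<Sum>i<Suc k. (p(k := sqrt n)) i * e' i x)" for x
        unfolding sum' g_eq using False n0 by simp
      then show ?thesis unfolding True by blast
    next
      case False
      then obtain c where "AE x in M. g' x = (\<Sum>i<k. c i * e i x)"
        using span g' by blast
      then have "AE x in M. g' x = (\<Sum>i<Suc k. (c(k := 0)) i * e' i x)"
        unfolding sum' by simp
      then show ?thesis by blast
    qed
    ultimately show ?thesis by blast
  qed
qed

text \<open>The form is continuous and the unit sphere compact, which gives a minimizer
  \<open>c\<close>; scaling by the norm extends the inequality from the sphere to every
  \<open>d\<close>.\<close>

lemma quadratic_form_attains_min_on_sphere:
  fixes F :: "nat \<Rightarrow> nat \<Rightarrow> real"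
  assumes "k > 0"
  shows "\<exists>c. (\<Sum>i<k. (c i)\<^sup>2) = 1 \<and> (\<forall>d. (\<Sum>i<k. (d i)\<^sup>2) *
    (\<Sum>i<k. \<Sum>j<k. c i * c j * F i j) \<le> (\<Sum>i<k. \<Sum>j<k. d i * d j * F i j))"
proof -
  define Q where "Q d = (\<Sum>i<k. \<Sum>j<k. d i * d j * F i j)" for d
  \<comment> \<open>Vectors are functions on all of \<open>nat\<close>. Pinning the coordinates from
    \<open>k\<close> on to 0 makes the box a product of compact sets, compact by Tychonoff, and the
    sphere condition is closed.\<close>
  define B :: "nat \<Rightarrow> real set" where "B i = (if i < k then {-1..1} else {0})" for i
  define S where "S = PiE UNIV B \<inter> {d. (\<Sum>i<k. (d i)\<^sup>2) = 1}"
  have cB: "compact (PiE UNIV B)"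
  proof -
    have "compactin (product_topology (\<lambda>i. euclidean) UNIV) (PiE UNIV B)"
      unfolding compactin_PiE by (auto simp: B_def)
    then show ?thesis by (metis compactin_euclidean_iff euclidean_product_topology)
  qed
  have "closed {d :: nat \<Rightarrow> real. (\<Sum>i<k. (d i)\<^sup>2) = 1}"
    by (intro closed_Collect_eq continuous_on_sum continuous_on_power continuous_on_const continuous_on_product_coordinates)
  with cB have cS: "compact S"
    unfolding S_def by (rule compact_Int_closed)
  \<comment> \<open>Cutting off the coordinates from \<open>k\<close> on brings every unit vector
    into \<open>S\<close>; the form \<open>Q\<close> does not see the change.\<close>
  have inS: "(\<lambda>i. if i < k then d i else 0) \<in> S" if "(\<Sum>i<k. (d i)\<^sup>2) = 1" for d
  proof -
    have "\<bar>d i\<bar> \<le> 1" if "i < k" for i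
    proof -
      have "(d i)\<^sup>2 \<le> 1"
        using that \<open>(\<Sum>i<k. (d i)\<^sup>2) = 1\<close> member_le_sum[of i "{..<k}" "\<lambda>i. (d i)\<^sup>2"] by auto
      then show ?thesis by (simp add: abs_square_le_1)
    qed
    then show ?thesis using that by (auto simp: S_def B_def abs_le_iff minus_le_iff)
  qed
  have "(\<Sum>i<k. ((if i = 0 then 1 else 0 :: real))\<^sup>2) = (\<Sum>i<k. if i = 0 then 1 else 0)"
    by (intro sum.cong) auto
  then have "S \<noteq> {}"
    using inS[of "\<lambda>i. if i = 0 then 1 else 0"] assms by auto
  moreover have "continuous_on S Q"
    unfolding Q_def by (intro continuous_on_sum continuous_on_mult continuous_on_const
        continuous_on_subset[OF continuous_on_product_coordinates subset_UNIV])
  ultimately obtain c where c: "c \<in> S" "\<And>d. d \<in> S \<Longrightarrow> Q c \<le> Q d"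
    using continuous_attains_inf[OF cS] by blast
  have "(\<Sum>i<k. (d i)\<^sup>2) * Q c \<le> Q d" for d
  proof (cases "(\<Sum>i<k. (d i)\<^sup>2) = 0")
    case True
    then have "d i = 0" if "i < k" for i
      using that by (simp add: sum_nonneg_eq_0_iff)
    then show ?thesis using True by (simp add: Q_def)
  next
    case False
    define n where "n = (\<Sum>i<k. (d i)\<^sup>2)"
    have n: "n > 0" using False unfolding n_def by (simp add: order_less_le sum_nonneg)
    define d' where "d' i = (if i < k then d i / sqrt n else 0)" for i
    have "(\<Sum>i<k. (d i / sqrt n)\<^sup>2) = 1"
      using n by (simp add: power_divide n_def[symmetric] flip: sum_divide_distrib)
    then have "Q c \<le> Q d'"
      unfolding d'_def by (intro c(2) inS[of "\<lambda>i. d i / sqrt n"])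
    also have "Q d' = Q d / n"
      unfolding Q_def d'_def sum_divide_distrib using n
      by (intro sum.cong refl) simp
    finally show ?thesis using n unfolding n_def[symmetric] by (simp add: field_simps)
  qed
  moreover have "(\<Sum>i<k. (c i)\<^sup>2) = 1" using c(1) by (simp add: S_def)
  ultimately show ?thesis unfolding Q_def by blast
qed

lemma integral_double_sum:
  fixes g :: "nat \<Rightarrow> nat \<Rightarrow> 'a \<Rightarrow> real"
  assumes "\<And>i j. i < k \<Longrightarrow> j < k \<Longrightarrow> integrable M (g i j)"
  shows "(\<integral>x. (\<Sum>i<k. \<Sum>j<k. a i j * g i j x) \<partial>M) = (\<Sum>i<k. \<Sum>j<k. a i j * (\<integral>x. g i j x \<partial>M))"
  using assms by (subst Bochner_Integration.integral_sum) (auto intro!: sum.cong)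

text \<open>This minimizes a Rayleigh quotient. In orthonormal coordinates the squared norm is the
  sum of squares of the coefficients and the integral against \<open>f\<close> is a quadratic form,
  so the minimum on the sphere applies. Stating the bound homogeneously lets unnormalized
  \<open>p\<close> be tested.\<close>

lemma integral_quadratic_ratio_attains_min:
  fixes V :: "('a \<Rightarrow> real) set"
  assumes add: "\<And>g h. g \<in> V \<Longrightarrow> h \<in> V \<Longrightarrow> (\<lambda>x. g x + h x) \<in> V"
    and cmult: "\<And>c g. g \<in> V \<Longrightarrow> (\<lambda>x. c * g x) \<in> V"
    and zero: "(\<lambda>x. 0) \<in> V"
    and int: "\<And>g h. g \<in> V \<Longrightarrow> h \<in> V \<Longrightarrow> integrable M (\<lambda>x. g x * h x)"
    and intf: "\<And>g h. g \<in> V \<Longrightarrow> h \<in> V \<Longrightarrow> integrable M (\<lambda>x. f x * (g x * h x))"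
    and meas: "\<And>g. g \<in> V \<Longrightarrow> g \<in> borel_measurable M" "f \<in> borel_measurable M"
    and "finite G" "G \<subseteq> V"
    and span: "\<And>g. g \<in> V \<Longrightarrow> \<exists>c. g = (\<lambda>x. \<Sum>u\<in>G. c u * u x)"
    and "u \<in> V" "(\<integral>x. (u x)\<^sup>2 \<partial>M) \<noteq> 0"
  obtains q where "q \<in> V" "(\<integral>x. (q x)\<^sup>2 \<partial>M) = 1"
    and "\<And>p. p \<in> V \<Longrightarrow> (\<integral>x. (p x)\<^sup>2 \<partial>M) * (\<integral>x. f x * (q x)\<^sup>2 \<partial>M) \<le> (\<integral>x. f x * (p x)\<^sup>2 \<partial>M)"
proof -
  obtain k :: nat and e where eV: "\<And>i. i < k \<Longrightarrow> e i \<in> V"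
    and orth: "\<And>i j. i < k \<Longrightarrow> j < k \<Longrightarrow> (\<integral>x. e i x * e j x \<partial>M) = (if i = j then 1 else 0)"
    and span': "\<And>g. g \<in> G \<Longrightarrow> \<exists>c. AE x in M. g x = (\<Sum>i<k. c i * e i x)"
    using orthonormal_exists[OF add cmult zero int \<open>finite G\<close> \<open>G \<subseteq> V\<close>] by blast
  define F where "F i j = (\<integral>x. f x * (e i x * e j x) \<partial>M)" for i j
  define S where "S c = (\<lambda>x. \<Sum>i<k. c i * e i x)" for c
  have SV: "S c \<in> V" for c
  proof -
    have "(\<lambda>x. \<Sum>i\<in>A. c i * e i x) \<in> V" if "finite A" "A \<subseteq> {..<k}" for A
      using that by (induction A rule: finite_induct) (auto intro!: zero add cmult eV)
    then show ?thesis unfolding S_def by simp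
  qed
  have sq: "(S c x)\<^sup>2 = (\<Sum>i<k. \<Sum>j<k. c i * c j * (e i x * e j x))" for c x
    by (simp add: S_def power2_eq_square sum_product algebra_simps)
  have norm_S: "(\<integral>x. (S c x)\<^sup>2 \<partial>M) = (\<Sum>i<k. (c i)\<^sup>2)" for c
  proof -
    have "(\<integral>x. (S c x)\<^sup>2 \<partial>M) = (\<Sum>i<k. \<Sum>j<k. c i * c j * (\<integral>x. e i x * e j x \<partial>M))"
      unfolding sq by (intro integral_double_sum int eV)
    also have "\<dots> = (\<Sum>i<k. \<Sum>j<k. if i = j then c i * c j else 0)"
      by (intro sum.cong) (auto simp: orth)
    finally show ?thesis by (simp add: power2_eq_square)
  qed
  have form_S: "(\<integral>x. f x * (S c x)\<^sup>2 \<partial>M) = (\<Sum>i<k. \<Sum>j<k. c i * c j * F i j)" for c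
  proof -
    have "f x * (S c x)\<^sup>2 = (\<Sum>i<k. \<Sum>j<k. c i * c j * (f x * (e i x * e j x)))" for x
      unfolding sq sum_distrib_left by (simp add: algebra_simps)
    then have "(\<integral>x. f x * (S c x)\<^sup>2 \<partial>M) =
        (\<integral>x. (\<Sum>i<k. \<Sum>j<k. c i * c j * (f x * (e i x * e j x))) \<partial>M)"
      by simp
    also have "\<dots> = (\<Sum>i<k. \<Sum>j<k. c i * c j * F i j)"
      unfolding F_def by (intro integral_double_sum intf eV)
    finally show ?thesis .
  qed
  \<comment> \<open>Up to null sets every \<open>p\<close> in \<open>V\<close> is some
    \<open>S c\<close>, and the integrals do not notice null sets.\<close>
  have rep: "\<exists>c. (\<integral>x. (p x)\<^sup>2 \<partial>M) = (\<integral>x. (S c x)\<^sup>2 \<partial>M) \<and>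
      (\<integral>x. f x * (p x)\<^sup>2 \<partial>M) = (\<integral>x. f x * (S c x)\<^sup>2 \<partial>M)" if "p \<in> V" for p
  proof -
    obtain a where a: "p = (\<lambda>x. \<Sum>u\<in>G. a u * u x)"
      using span[OF \<open>p \<in> V\<close>] by blast
    obtain b where b: "\<And>u. u \<in> G \<Longrightarrow> AE x in M. u x = (\<Sum>i<k. b u i * e i x)"
      using span' by metis
    define c where "c i = (\<Sum>u\<in>G. a u * b u i)" for i
    have "AE x in M. \<forall>u\<in>G. u x = (\<Sum>i<k. b u i * e i x)"
      using b \<open>finite G\<close> by (simp add: AE_finite_all)
    then have "AE x in M. p x = S c x"
    proof eventually_elim
      case (elim x)
      then have "p x = (\<Sum>u\<in>G. \<Sum>i<k. a u * b u i * e i x)"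
        unfolding a
      proof (intro sum.cong refl)
        fix u assume "u \<in> G"
        then have "u x = (\<Sum>i<k. b u i * e i x)"
          using elim by blast
        then show "a u * u x = (\<Sum>i<k. a u * b u i * e i x)"
          by (simp add: sum_distrib_left mult.assoc)
      qed
      also have "\<dots> = S c x"
        unfolding S_def c_def sum_distrib_right by (rule sum.swap)
      finally show ?case .
    qed
    moreover have "p \<in> borel_measurable M" "S c \<in> borel_measurable M"
      using meas(1) \<open>p \<in> V\<close> SV by auto
    ultimately show ?thesis
      using meas(2) by (intro exI[of _ c] conjI integral_cong_AE) auto
  qed
  \<comment> \<open>With an empty orthonormal system every norm in \<open>V\<close> would be 0,
    contrary to the choice of \<open>u\<close>.\<close>
  have "k > 0"
  proof (rule ccontr)
    assume "\<not> k > 0"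
    then show False
      using rep[OF \<open>u \<in> V\<close>] \<open>(\<integral>x. (u x)\<^sup>2 \<partial>M) \<noteq> 0\<close> norm_S by simp
  qed
  then obtain c where c: "(\<Sum>i<k. (c i)\<^sup>2) = 1"
    "\<forall>d. (\<Sum>i<k. (d i)\<^sup>2) * (\<Sum>i<k. \<Sum>j<k. c i * c j * F i j) \<le> (\<Sum>i<k. \<Sum>j<k. d i * d j * F i j)"
    using quadratic_form_attains_min_on_sphere[of k F] by blast
  show thesis
  proof (rule that[of "S c"])
    show "(\<integral>x. (p x)\<^sup>2 \<partial>M) * (\<integral>x. f x * (S c x)\<^sup>2 \<partial>M) \<le> (\<integral>x. f x * (p x)\<^sup>2 \<partial>M)"
      if p: "p \<in> V" for p
    proof -
      obtain d where "(\<integral>x. (p x)\<^sup>2 \<partial>M) = (\<integral>x. (S d x)\<^sup>2 \<partial>M)"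
        "(\<integral>x. f x * (p x)\<^sup>2 \<partial>M) = (\<integral>x. f x * (S d x)\<^sup>2 \<partial>M)"
        using rep[OF p] by blast
      then show ?thesis using c(2)[rule_format, of d] by (simp add: norm_S form_S)
    qed
  qed (use c(1) norm_S SV in auto)
qed

section \<open>Chebyshev polynomials\<close>

text \<open>Chebyshev polynomials of the first kind, kept as functions; their degree enters only
  through \<open>poly_funs_cheb\<close>.\<close>

fun cheb :: "nat \<Rightarrow> real \<Rightarrow> real" where
  "cheb 0 x = 1"
| "cheb (Suc 0) x = x"
| "cheb (Suc (Suc n)) x = 2 * x * cheb (Suc n) x - cheb n x"

lemma cheb_cos: "cheb n (cos t) = cos (real n * t)"
proof (induction n rule: induct_nat_012)
  case (ge2 n)
  let ?a = "real (Suc n) * t"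
  have "cos (?a + t) = 2 * cos t * cos ?a - cos (?a - t)"
    by (simp add: cos_add cos_diff)
  moreover have "?a + t = real (Suc (Suc n)) * t" "?a - t = real n * t"
    by (simp_all add: algebra_simps)
  ultimately show ?case
    using ge2 by simp
qed simp_all

lemma abs_cheb_le_1:
  assumes "\<bar>x\<bar> \<le> 1"
  shows "\<bar>cheb n x\<bar> \<le> 1"
  using cheb_cos[of n "arccos x"] cos_arccos_abs[OF assms] by (metis abs_cos_le_one)

text \<open>At the point (y + z) / 2 the recurrence has the characteristic roots y and z, since
  their product is 1. This gives access to the values outside [-1, 1], where the cosine formula says
  nothing.\<close>

lemma cheb_mean_inverse:
  assumes "y * z = 1"
  shows "cheb n ((y + z) / 2) = (y ^ n + z ^ n) / 2"
proof (induction n rule: induct_nat_012)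
  case (ge2 n)
  have "(y + z) * (y ^ Suc n + z ^ Suc n) = y ^ Suc (Suc n) + z ^ Suc (Suc n) + y * z * (y ^ n + z ^ n)"
    by (simp add: algebra_simps)
  then show ?case
    using ge2 assms by (simp add: field_simps)
qed simp_all

text \<open>Apply the previous formula to y = x + s and z = x - s with s = sqrt (x^2 - 1), drop the
  nonnegative power of z, and use s >= a, which follows from x^2 >= (1 + a^2 / 2)^2 >= 1 +
  a^2.\<close>

lemma cheb_ge:
  assumes "1 + a\<^sup>2 / 2 \<le> x" "0 \<le> a"
  shows "(1 + a) ^ n / 2 \<le> cheb n x"
proof -
  define s where "s = sqrt (x\<^sup>2 - 1)"
  have x1: "1 \<le> x"
    using assms(1) zero_le_power2[of a] by linarith
  have "1 + a\<^sup>2 \<le> 1 + a\<^sup>2 + (a\<^sup>2 / 2)\<^sup>2"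
    by simp
  also have "\<dots> = (1 + a\<^sup>2 / 2)\<^sup>2"
    by (simp add: power2_sum)
  also have "\<dots> \<le> x\<^sup>2"
    by (rule power_mono[OF assms(1)]) simp
  finally have sa: "a \<le> s"
    unfolding s_def by (simp add: real_le_rsqrt)
  have "s\<^sup>2 = x\<^sup>2 - 1"
    unfolding s_def using x1 by simp
  then have "(x + s) * (x - s) = 1"
    by (simp add: algebra_simps power2_eq_square)
  then have "cheb n x = ((x + s) ^ n + (x - s) ^ n) / 2"
    using cheb_mean_inverse[of "x + s" "x - s" n] by simp
  moreover have "0 \<le> x - s"
    using \<open>(x + s) * (x - s) = 1\<close> x1 sa assms(2) by (smt (verit) mult_pos_neg)
  then have "0 \<le> (x - s) ^ n"
    by simp
  moreover have "(1 + a) ^ n \<le> (x + s) ^ n"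
    using assms(2) sa x1 by (intro power_mono) auto
  ultimately show ?thesis
    by simp
qed

text \<open>Each step of the recurrence multiplies by \<open>g\<close> once and so costs one more
  \<open>d\<close>; the recurrence looks back two steps, hence the induction over all smaller
  indices.\<close>

lemma poly_funs_cheb:
  assumes "g \<in> poly_funs d"
  shows "(\<lambda>x. cheb n (g x)) \<in> poly_funs (n * d)"
proof (induction n rule: less_induct)
  case (less n)
  consider "n = 0" | "n = Suc 0" | k where "n = Suc (Suc k)"
    by (metis not0_implies_Suc)
  then show ?case
  proof cases
    case 3
    have "(\<lambda>x. 2 * (g x * cheb (Suc k) (g x))) \<in> poly_funs (d + Suc k * d)"
      by (intro poly_funs_cmult poly_funs_mult assms less.IH) (simp add: 3)
    moreover have "(\<lambda>x. (- 1) * cheb k (g x)) \<in> poly_funs (k * d)"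
      by (intro poly_funs_cmult less.IH) (simp add: 3)
    then have "(\<lambda>x. (- 1) * cheb k (g x)) \<in> poly_funs (d + Suc k * d)"
      using poly_funs_mono[of "k * d" "d + Suc k * d"] by auto
    ultimately have "(\<lambda>x. 2 * (g x * cheb (Suc k) (g x)) + (- 1) * cheb k (g x))
        \<in> poly_funs (d + Suc k * d)"
      by (rule poly_funs_add)
    then show ?thesis
      by (simp add: 3 mult.assoc)
  qed (use assms poly_funs_const in auto)
qed

section \<open>The upper bounds\<close>

lemma integrable_lebesgue_on_compact:
  fixes g :: "'a::euclidean_space \<Rightarrow> real"
  assumes "compact K" "continuous_on K g"
  shows "integrable (lebesgue_on K) g"
proof -
  have K: "K \<in> lmeasurable"
    using assms(1) by (rule lmeasurable_compact)
  interpret finite_measure "lebesgue_on K"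
    using K by (rule finite_measure_lebesgue_on)
  obtain b where "\<And>x. x \<in> K \<Longrightarrow> \<bar>g x\<bar> \<le> b"
    using compact_imp_bounded[OF compact_continuous_image[OF assms(2,1)]]
    by (auto simp: bounded_iff)
  moreover have "g \<in> borel_measurable (lebesgue_on K)"
    using K assms(2) by (intro continuous_imp_measurable_on_sets_lebesgue) auto
  ultimately show ?thesis
    by (intro integrable_const_bound[where B = b]) (auto simp: AE_restrict_space_iff)
qed

text \<open>Compactness bounds both factors; the difference of products then splits into two terms,
  each a bounded factor times a Lipschitz difference.\<close>

lemma ex_lipschitz_on_mult:
  fixes g h :: "'a::metric_space \<Rightarrow> real"
  assumes "compact S" "\<exists>L. L-lipschitz_on S g" "\<exists>L. L-lipschitz_on S h"
  shows "\<exists>L. L-lipschitz_on S (\<lambda>x. g x * h x)"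
proof -
  obtain L M where L: "L-lipschitz_on S g" and M: "M-lipschitz_on S h"
    using assms by auto
  have bdd: "\<exists>b\<ge>0. \<forall>x\<in>S. \<bar>u x\<bar> \<le> b" if u: "continuous_on S u" for u :: "'a \<Rightarrow> real"
  proof -
    obtain b where "\<And>x. x \<in> S \<Longrightarrow> \<bar>u x\<bar> \<le> b"
      using compact_imp_bounded[OF compact_continuous_image[OF u assms(1)]]
      by (auto simp: bounded_iff)
    then show ?thesis
      by (intro exI[of _ "max b 0"]) fastforce
  qed
  obtain a where a: "a \<ge> 0" "\<And>x. x \<in> S \<Longrightarrow> \<bar>g x\<bar> \<le> a"
    using bdd[OF lipschitz_on_continuous_on[OF L]] by blast
  obtain b where b: "b \<ge> 0" "\<And>x. x \<in> S \<Longrightarrow> \<bar>h x\<bar> \<le> b"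
    using bdd[OF lipschitz_on_continuous_on[OF M]] by blast
  have "(a * M + b * L)-lipschitz_on S (\<lambda>x. g x * h x)"
  proof (rule lipschitz_onI)
    fix x y assume xy: "x \<in> S" "y \<in> S"
    have "\<bar>g x * h x - g y * h y\<bar> = \<bar>g x * (h x - h y) + h y * (g x - g y)\<bar>"
      by (simp add: algebra_simps)
    also have "\<dots> \<le> \<bar>g x\<bar> * \<bar>h x - h y\<bar> + \<bar>h y\<bar> * \<bar>g x - g y\<bar>"
      by (metis abs_mult abs_triangle_ineq)
    also have "\<dots> \<le> a * (M * dist x y) + b * (L * dist x y)"
      using xy a b lipschitz_onD[OF L xy] lipschitz_onD[OF M xy]
      by (intro add_mono mult_mono) (auto simp: dist_real_def)
    finally show "dist (g x * h x) (g y * h y) \<le> (a * M + b * L) * dist x y"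
      by (simp add: dist_real_def algebra_simps)
  qed (use a b lipschitz_on_nonneg[OF L] lipschitz_on_nonneg[OF M] in simp)
  then show ?thesis ..
qed

text \<open>Supplies the at most linear growth of \<open>f\<close> away from a minimizer. Lipschitz
  functions on \<open>S\<close> are closed under the products and sums that build a
  polynomial.\<close>

lemma ex_lipschitz_on_peval:
  assumes "compact S"
  shows "\<exists>L. L-lipschitz_on S (peval p)"
proof -
  have const: "\<exists>L. L-lipschitz_on S (\<lambda>x. c :: real)" for c
    using lipschitz_on_constant by blast
  have coord: "\<exists>L. L-lipschitz_on S (\<lambda>x. x $ i)" for i :: 'a
    by (intro exI[of _ 1] lipschitz_onI) (auto simp: dist_vec_nth_le)
  have power: "\<exists>L. L-lipschitz_on S (\<lambda>x. (x $ i) ^ k)" for i :: 'a and k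
    by (induction k) (auto intro!: ex_lipschitz_on_mult[OF assms] coord const)
  have "\<exists>L. L-lipschitz_on S (\<lambda>x. \<Prod>i\<in>A. (x $ i) ^ e i)" for A :: "'a set" and e
    by (induction A rule: infinite_finite_induct)
      (auto intro!: ex_lipschitz_on_mult[OF assms] power const)
  then have lip_term: "\<exists>L. L-lipschitz_on S (\<lambda>x. c * monomial_at m x)" for c and m :: "'a \<Rightarrow>\<^sub>0 nat"
    unfolding monomial_at_def by (intro ex_lipschitz_on_mult[OF assms] const)
  have "\<exists>L. L-lipschitz_on S (\<lambda>x. \<Sum>m\<in>A. c m * monomial_at m x)"
    for A :: "('a \<Rightarrow>\<^sub>0 nat) set" and c :: "('a \<Rightarrow>\<^sub>0 nat) \<Rightarrow> real"
    by (induction A rule: infinite_finite_induct)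
      (use lipschitz_on_add lip_term in \<open>simp_all add: const, blast\<close>)
  then show ?thesis
    by (simp add: peval_eq_sum[OF finite_keys subset_refl, abs_def])
qed

section \<open>The two minima\<close>

lemma min_value_attained:
  assumes "compact K" "K \<noteq> {}"
  obtains x0 where "x0 \<in> K" "min_value K f = peval f x0" "\<And>x. x \<in> K \<Longrightarrow> min_value K f \<le> peval f x"
proof -
  obtain x0 where x0: "x0 \<in> K" "\<And>x. x \<in> K \<Longrightarrow> peval f x0 \<le> peval f x"
    using continuous_attains_inf[OF assms continuous_on_peval] by blast
  then have "min_value K f = peval f x0"
    unfolding min_value_def by (intro Least_equality) auto
  with x0 show thesis
    using that by metis
qed

text \<open>Justifies the use of \<open>LEAST\<close> in \<open>upper_bound\<close>. The optimum is
  a single square: every summand of a feasible sum of squares satisfies the homogeneous inequality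
  for \<open>q\<close>, and adding these bounds the whole sum.\<close>

lemma upper_bound_attained:
  fixes K :: "(real ^ 'n::finite) set"
  assumes "compact K" "measure lebesgue K > 0"
  obtains q where "q \<in> poly_funs r" "(\<integral>x. (q x)\<^sup>2 \<partial>lebesgue_on K) = 1"
    and "upper_bound K f r = (\<integral>x. peval f x * (q x)\<^sup>2 \<partial>lebesgue_on K)"
    and "\<And>p. p \<in> poly_funs r \<Longrightarrow> (\<integral>x. (p x)\<^sup>2 \<partial>lebesgue_on K) * upper_bound K f r
           \<le> (\<integral>x. peval f x * (p x)\<^sup>2 \<partial>lebesgue_on K)"
proof -
  let ?M = "lebesgue_on K"
  have K: "K \<in> sets lebesgue"
    using lmeasurable_compact[OF assms(1)] by blast
  have int: "continuous_on K g \<Longrightarrow> integrable ?M g" for g :: "real ^ 'n \<Rightarrow> real"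
    by (rule integrable_lebesgue_on_compact[OF assms(1)])
  have meas: "continuous_on K g \<Longrightarrow> g \<in> borel_measurable ?M" for g :: "real ^ 'n \<Rightarrow> real"
    using int by blast
  note cont = continuous_on_poly_funs continuous_on_peval
  let ?G = "monomial_at ` {m :: 'n \<Rightarrow>\<^sub>0 nat. monomial_degree m \<le> r}"
  have span: "\<exists>c. g = (\<lambda>x. \<Sum>u\<in>?G. c u * u x)" if "g \<in> poly_funs r" for g
  proof -
    obtain c where "g = (\<lambda>x. \<Sum>m | monomial_degree m \<le> r. c m * monomial_at m x)"
      using poly_funs_eq_sum_monomials[OF \<open>g \<in> poly_funs r\<close>] by blast
    \<comment> \<open>Exponents with the same monomial function are grouped, because
      \<open>?G\<close> is a set of functions rather than of exponents.\<close>
    also have "\<dots> = (\<lambda>x. \<Sum>u\<in>?G. (\<Sum>m | monomial_degree m \<le> r \<and> monomial_at m = u. c m) * u x)"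
    proof
      fix x
      have "(\<Sum>m | monomial_degree m \<le> r. c m * monomial_at m x) =
          (\<Sum>u\<in>?G. \<Sum>m | m \<in> {m. monomial_degree m \<le> r} \<and> monomial_at m = u. c m * monomial_at m x)"
        by (rule sum.image_gen) (rule finite_monomial_degree_le)
      then show "(\<Sum>m | monomial_degree m \<le> r. c m * monomial_at m x) =
          (\<Sum>u\<in>?G. (\<Sum>m | monomial_degree m \<le> r \<and> monomial_at m = u. c m) * u x)"
        by (simp add: sum_distrib_right)
    qed
    finally show ?thesis
      by (rule exI[of _ "\<lambda>u. \<Sum>m | monomial_degree m \<le> r \<and> monomial_at m = u. c m"])
  qed
  \<comment> \<open>The constant 1 serves as the function of nonzero norm; its squared norm is the
    volume of \<open>K\<close>.\<close>
  have one: "(\<lambda>x. 1) \<in> poly_funs r" "(\<integral>x. (1 :: real)\<^sup>2 \<partial>?M) \<noteq> 0"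
    using assms(2) K by (simp_all add: poly_funs_const measure_restrict_space)
  obtain q where q: "q \<in> poly_funs r" "(\<integral>x. (q x)\<^sup>2 \<partial>?M) = 1"
    and q_min: "\<And>p. p \<in> poly_funs r \<Longrightarrow> (\<integral>x. (p x)\<^sup>2 \<partial>?M) * (\<integral>x. peval f x * (q x)\<^sup>2 \<partial>?M)
      \<le> (\<integral>x. peval f x * (p x)\<^sup>2 \<partial>?M)"
  proof (rule integral_quadratic_ratio_attains_min[of "poly_funs r" ?M "peval f" ?G "\<lambda>x. 1"])
    show "integrable ?M (\<lambda>x. g x * h x)" "integrable ?M (\<lambda>x. peval f x * (g x * h x))"
      if "g \<in> poly_funs r" "h \<in> poly_funs r" for g h :: "real ^ 'n \<Rightarrow> real"
      using that[THEN continuous_on_poly_funs] by (auto intro!: int continuous_on_mult continuous_on_peval)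
    show "finite ?G"
      by (simp add: finite_monomial_degree_le)
  qed (use one span in \<open>auto intro: poly_funs_add poly_funs_cmult poly_funs_const poly_funs_monomial
        meas cont\<close>)
  let ?m = "\<integral>x. peval f x * (q x)\<^sup>2 \<partial>?M"
  have sos_ge: "(\<integral>x. (\<Sum>q\<leftarrow>qs. (peval q x)\<^sup>2) \<partial>?M) * ?m
      \<le> (\<integral>x. peval f x * (\<Sum>q\<leftarrow>qs. (peval q x)\<^sup>2) \<partial>?M)"
    if "\<And>q. q \<in> set qs \<Longrightarrow> peval q \<in> poly_funs r" for qs
    using that
  proof (induction qs)
    case (Cons p ps)
    have cs: "continuous_on K (\<lambda>x. \<Sum>q\<leftarrow>ps. (peval q x)\<^sup>2)"
      by (induction ps) (auto intro!: continuous_intros continuous_on_peval)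
    have "(\<integral>x. (peval p x)\<^sup>2 + (\<Sum>q\<leftarrow>ps. (peval q x)\<^sup>2) \<partial>?M) =
        (\<integral>x. (peval p x)\<^sup>2 \<partial>?M) + (\<integral>x. (\<Sum>q\<leftarrow>ps. (peval q x)\<^sup>2) \<partial>?M)"
      by (intro Bochner_Integration.integral_add int continuous_on_power continuous_on_peval cs)
    moreover have "(\<integral>x. peval f x * (peval p x)\<^sup>2 + peval f x * (\<Sum>q\<leftarrow>ps. (peval q x)\<^sup>2) \<partial>?M) =
        (\<integral>x. peval f x * (peval p x)\<^sup>2 \<partial>?M) + (\<integral>x. peval f x * (\<Sum>q\<leftarrow>ps. (peval q x)\<^sup>2) \<partial>?M)"
      by (intro Bochner_Integration.integral_add int continuous_on_mult continuous_on_power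
          continuous_on_peval cs)
    ultimately show ?case
      using Cons q_min[of "peval p"] by (simp add: distrib_left distrib_right add_mono)
  qed simp
  have "upper_bound K f r = ?m"
    unfolding upper_bound_def
  proof (rule Least_equality)
    obtain p where p: "q = peval p" "total_degree p \<le> r"
      using q(1) by (auto simp: poly_funs_def)
    have "p\<^sup>2 = (\<Sum>q\<leftarrow>[p]. q\<^sup>2)"
      by simp
    then have "p\<^sup>2 \<in> sos_polys r"
      using total_degree_mult_le[OF p(2) p(2)]
      unfolding sos_polys_def mem_Collect_eq by (metis power2_eq_square mult_2)
    then show "\<exists>\<sigma>\<in>sos_polys r. (\<integral>x. peval \<sigma> x \<partial>?M) = 1 \<and> ?m = (\<integral>x. peval f x * peval \<sigma> x \<partial>?M)"
      using q(2) by (intro bexI[of _ "p\<^sup>2"]) (simp_all add: p peval_power)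
  next
    fix v assume "\<exists>\<sigma>\<in>sos_polys r. (\<integral>x. peval \<sigma> x \<partial>?M) = 1 \<and> v = (\<integral>x. peval f x * peval \<sigma> x \<partial>?M)"
    then obtain qs where qs: "total_degree (\<Sum>q\<leftarrow>qs. q\<^sup>2) \<le> 2 * r"
      "(\<integral>x. (\<Sum>q\<leftarrow>qs. (peval q x)\<^sup>2) \<partial>?M) = 1"
      "v = (\<integral>x. peval f x * (\<Sum>q\<leftarrow>qs. (peval q x)\<^sup>2) \<partial>?M)"
      by (auto simp: sos_polys_def peval_sum_list[abs_def] peval_power)
    then show "?m \<le> v"
      using sos_ge[of qs, OF sos_summand_in_poly_funs[OF qs(1)]] by simp
  qed
  with q q_min show thesis
    using that[OF q] by simp
qed

text \<open>\<open>f\<close> averaged against a probability density is at least its minimum. With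
  the difference known to be nonnegative, an upper estimate gives the asymptotic bound.\<close>

lemma upper_bound_ge_min_value:
  assumes "compact K" "measure lebesgue K > 0"
  shows "min_value K f \<le> upper_bound K f r"
proof -
  have "K \<noteq> {}" using assms(2) by auto
  obtain x0 where x0: "x0 \<in> K" "min_value K f = peval f x0"
    "\<And>x. x \<in> K \<Longrightarrow> min_value K f \<le> peval f x"
    using min_value_attained[OF assms(1) \<open>K \<noteq> {}\<close>] by blast
  obtain q where q: "q \<in> poly_funs r" "(\<integral>x. (q x)\<^sup>2 \<partial>lebesgue_on K) = 1"
    "upper_bound K f r = (\<integral>x. peval f x * (q x)\<^sup>2 \<partial>lebesgue_on K)"
    by (rule upper_bound_attained[OF assms])
  have cq: "continuous_on K (\<lambda>x. (q x)\<^sup>2)"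
    using q(1) by (intro continuous_on_power continuous_on_poly_funs)
  have "(\<integral>x. min_value K f * (q x)\<^sup>2 \<partial>lebesgue_on K) \<le> upper_bound K f r"
    unfolding q(3) using cq x0(3)
    by (intro integral_mono integrable_lebesgue_on_compact assms(1) continuous_on_mult
        continuous_on_const continuous_on_peval mult_right_mono) auto
  then show ?thesis
    using q(2) by simp
qed

section \<open>The estimate for a fixed width \<open>a\<close>\<close>

text \<open>On the ball of radius a^2 W / (2 L) the excess of \<open>f\<close> is at most a^2 W / 2,
  and \<open>v\<close> bounds the volume there from below. The last term is the contribution of the
  region of large excess, relative to the mass of the test polynomial.\<close>

lemma upper_bound_le_cheb:
  fixes K :: "(real ^ 'n::finite) set" and L W a v :: real
  assumes "compact K" and x0: "x0 \<in> K"
    and nonneg: "\<And>x. x \<in> K \<Longrightarrow> peval f x0 \<le> peval f x"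
    and W: "\<And>x. x \<in> K \<Longrightarrow> peval f x - peval f x0 \<le> W" "0 < W"
    and L: "\<And>x. x \<in> K \<Longrightarrow> peval f x - peval f x0 \<le> L * dist x x0" "0 < L"
    and a: "0 < a" "a \<le> 1" and deg: "s * total_degree f \<le> r"
    and v: "0 < v" "v \<le> measure lebesgue (K \<inter> cball x0 (a\<^sup>2 * W / (2 * L)))"
  shows "upper_bound K f r - peval f x0
    \<le> a\<^sup>2 * W + 4 * W * measure lebesgue K / (v * (1 + a) ^ (2 * s))"
proof -
  let ?M = "lebesgue_on K" and ?m = "peval f x0"
  define B where "B = K \<inter> cball x0 (a\<^sup>2 * W / (2 * L))"
  have K: "K \<in> lmeasurable" and BK: "B \<in> lmeasurable" "B \<subseteq> K"
    using assms(1) by (auto simp: B_def intro: lmeasurable_compact compact_Int_closed)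
  have vK: "measure lebesgue K > 0"
    using v measure_mono_fmeasurable[OF BK(2) _ K] BK(1) by (auto simp: B_def)
  have int: "continuous_on K g \<Longrightarrow> integrable ?M g" for g :: "real ^ 'n \<Rightarrow> real"
    by (rule integrable_lebesgue_on_compact[OF assms(1)])
  \<comment> \<open>\<open>t\<close> rescales the excess of \<open>f\<close> on \<open>K\<close> to
    [0, 1]. The argument of \<open>cheb\<close> then stays in [-1, 1] for t >= a^2 and is at least 1
    + a^2 / 2 for t <= a^2 / 2.\<close>
  define t where "t x = (peval f x - ?m) / W" for x
  define p where "p x = cheb s (1 + a\<^sup>2 - t x)" for x
  have "(\<lambda>x. (1 + a\<^sup>2 + ?m / W) + (- 1 / W) * peval f x) \<in> poly_funs (total_degree f)"
    by (intro poly_funs_add poly_funs_cmult poly_funs_const poly_funs_peval order_refl)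
  moreover have "(1 + a\<^sup>2 + ?m / W) + (- 1 / W) * peval f x = 1 + a\<^sup>2 - t x" for x
    using W(2) by (simp add: t_def field_simps)
  ultimately have "(\<lambda>x. 1 + a\<^sup>2 - t x) \<in> poly_funs (total_degree f)"
    by (simp only:)
  then have p: "p \<in> poly_funs r"
    unfolding p_def using poly_funs_cheb poly_funs_mono[OF deg] by blast
  have cp: "continuous_on K (\<lambda>x. (p x)\<^sup>2)"
    using p by (intro continuous_on_power continuous_on_poly_funs)
  define I where "I = (\<integral>x. (p x)\<^sup>2 \<partial>?M)"
  have t01: "0 \<le> t x" "t x \<le> 1" if "x \<in> K" for x
    using nonneg[OF that] W(1)[OF that] W(2) by (simp_all add: t_def)
  \<comment> \<open>The right-hand side adds the bounds of two regions: where t <= a^2 the excess is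
    at most a^2 W, and elsewhere the square is at most 1 and the excess at most W.\<close>
  have small: "(peval f x - ?m) * (p x)\<^sup>2 \<le> a\<^sup>2 * W * (p x)\<^sup>2 + W" if x: "x \<in> K" for x
  proof (cases "t x \<le> a\<^sup>2")
    case True
    then have "peval f x - ?m \<le> a\<^sup>2 * W"
      using W(2) by (simp add: t_def field_simps)
    then have "(peval f x - ?m) * (p x)\<^sup>2 \<le> a\<^sup>2 * W * (p x)\<^sup>2"
      by (intro mult_right_mono) auto
    then show ?thesis
      using W(2) by linarith
  next
    case False
    then have "\<bar>1 + a\<^sup>2 - t x\<bar> \<le> 1"
      using t01[OF x] by (smt (verit) zero_le_power2)
    then have "(p x)\<^sup>2 \<le> 1"
      unfolding p_def abs_square_le_1 by (rule abs_cheb_le_1)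
    then have "(peval f x - ?m) * (p x)\<^sup>2 \<le> W * 1"
      using W(1)[OF x] W(2) by (intro mult_mono) auto
    moreover have "0 \<le> a\<^sup>2 * W * (p x)\<^sup>2"
      using W(2) by simp
    ultimately show ?thesis
      by linarith
  qed
  \<comment> \<open>Squaring the lower bound (1 + a)^s / 2 gives the factor 1/4; off
    \<open>B\<close> the left side is 0.\<close>
  have large: "indicator B x * ((1 + a) ^ (2 * s) / 4) \<le> (p x)\<^sup>2" if "x \<in> K" for x
  proof (cases "x \<in> B")
    case True
    then have "peval f x - ?m \<le> L * (a\<^sup>2 * W / (2 * L))"
      using L(1)[OF that] L(2) by (smt (verit) B_def IntD2 dist_commute mem_cball mult_left_mono)
    then have "t x \<le> a\<^sup>2 / 2"
      using W(2) L(2) by (simp add: t_def field_simps)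
    then have "(1 + a) ^ s / 2 \<le> p x"
      unfolding p_def using a by (intro cheb_ge) auto
    then have "((1 + a) ^ s / 2)\<^sup>2 \<le> (p x)\<^sup>2"
      using a by (intro power_mono) auto
    then show ?thesis
      using True by (simp add: power_divide power_mult mult.commute flip: power_mult)
  qed simp
  have "(\<integral>x. indicator B x * ((1 + a) ^ (2 * s) / 4) \<partial>?M) \<le> I"
    unfolding I_def
  proof (rule integral_mono)
    show "integrable ?M (\<lambda>x. indicator B x * ((1 + a) ^ (2 * s) / 4))"
      using K BK finite_measure.emeasure_finite[OF finite_measure_lebesgue_on[OF K]]
      by (intro integrable_mult_left integrable_real_indicator)
        (auto simp: sets_restrict_space_iff less_top[symmetric])
  qed (use large int[OF cp] in auto)
  moreover have "(\<integral>x. indicator B x * ((1 + a) ^ (2 * s) / 4) \<partial>?M)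
      = measure lebesgue B * ((1 + a) ^ (2 * s) / 4)"
    using K BK by (simp add: measure_restrict_space Int_absorb2)
  moreover have "v * ((1 + a) ^ (2 * s) / 4) \<le> measure lebesgue B * ((1 + a) ^ (2 * s) / 4)"
    using v(2) a by (intro mult_right_mono) (auto simp: B_def)
  ultimately have I: "v * (1 + a) ^ (2 * s) / 4 \<le> I"
    by linarith
  have Ipos: "0 < v * (1 + a) ^ (2 * s) / 4"
    using v(1) a by simp
  \<comment> \<open>\<open>p\<close> has mass \<open>I\<close> rather than 1, so the homogeneous
    inequality is used.\<close>
  have "I * upper_bound K f r \<le> (\<integral>x. peval f x * (p x)\<^sup>2 \<partial>?M)"
    unfolding I_def by (rule upper_bound_attained[OF assms(1) vK, of r f]) (simp add: p)
  also have "\<dots> = (\<integral>x. (peval f x - ?m) * (p x)\<^sup>2 + ?m * (p x)\<^sup>2 \<partial>?M)"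
    by (simp add: algebra_simps)
  also have "\<dots> = (\<integral>x. (peval f x - ?m) * (p x)\<^sup>2 \<partial>?M) + ?m * I"
    unfolding I_def
    by (subst Bochner_Integration.integral_add)
      (auto intro!: int continuous_on_mult continuous_on_diff cp continuous_on_peval)
  also have "(\<integral>x. (peval f x - ?m) * (p x)\<^sup>2 \<partial>?M) \<le> (\<integral>x. a\<^sup>2 * W * (p x)\<^sup>2 + W \<partial>?M)"
    using small by (intro integral_mono int continuous_on_mult continuous_on_add continuous_on_diff
        cp continuous_on_peval continuous_on_const) auto
  also have "\<dots> = a\<^sup>2 * W * I + W * measure lebesgue K"
    unfolding I_def using K
    by (subst Bochner_Integration.integral_add)
      (auto intro!: int continuous_on_mult cp simp: measure_restrict_space)
  finally have "(upper_bound K f r - ?m) * I \<le> a\<^sup>2 * W * I + W * measure lebesgue K"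
    by (simp add: algebra_simps)
  then have "upper_bound K f r - ?m \<le> a\<^sup>2 * W + W * measure lebesgue K / I"
    using order_less_le_trans[OF Ipos I] by (simp add: field_simps)
  also have "W * measure lebesgue K / I \<le> W * measure lebesgue K / (v * (1 + a) ^ (2 * s) / 4)"
    using I Ipos W(2) vK by (intro divide_left_mono mult_pos_pos[OF _ Ipos]) simp_all
  finally show ?thesis
    by (simp add: mult_ac)
qed

section \<open>Choice of the width \<open>a\<close> and the asymptotic rate\<close>

text \<open>Reverses 1 + a <= exp a on [0, 1] at the price of halving the exponent, so that powers
  of 1 + a can be compared with exponentials.\<close>

lemma exp_half_le:
  fixes a :: real
  assumes "0 \<le> a" "a \<le> 1"
  shows "exp (a / 2) \<le> 1 + a"
proof -
  have "exp (a / 2) \<le> 1 + a / 2 + (a / 2)\<^sup>2"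
    using assms by (intro exp_bound) auto
  also have "(a / 2)\<^sup>2 \<le> a / 2"
    using assms mult_left_mono[of a 1 a] by (simp add: power2_eq_square)
  finally show ?thesis by simp
qed

text \<open>\<open>a\<close> is chosen so that a r / (2 d) = (2 N + 2) ln r. Of the exponent, 2 N
  later cancels the volume loss of order r^(-2N), and the remaining 2 gives the rate r^(-2).\<close>

lemma needle_growth:
  fixes a N :: real and r d :: nat
  assumes "1 \<le> d" "2 * d \<le> r" "0 \<le> N" and a: "a = 2 * d * (2 * N + 2) * ln r / r" "a \<le> 1"
  shows "r powr (2 * N + 2) \<le> (1 + a) ^ (2 * (r div d))"
proof -
  let ?s = "r div d"
  have r: "1 \<le> r" "0 < real r" using assms by auto
  have a0: "0 \<le> a" unfolding a(1) using r assms(3) by simp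
  \<comment> \<open>Rounding down loses less than 1, and r / d >= 2, so at least half of r / d
    remains.\<close>
  have "r < d * (?s + 1)"
    using assms(1) by (simp add: dividend_less_times_div)
  then have "real r < real d * (real ?s + 1)"
    by (metis of_nat_1 of_nat_add of_nat_less_iff of_nat_mult)
  moreover have "2 * real d \<le> real r"
    using assms(2) by (metis of_nat_le_iff of_nat_mult of_nat_numeral)
  ultimately have s: "r / (2 * d) \<le> ?s"
    using assms(1) by (simp add: field_simps)
  have "r powr (2 * N + 2) = exp (a * (r / (2 * d)))"
    using r assms(1) by (simp add: powr_def a(1))
  also have "\<dots> \<le> exp (a * ?s)"
    using mult_left_mono[OF s a0] by simp
  also have "\<dots> = exp (a / 2) ^ (2 * ?s)"
    by (simp flip: exp_of_nat_mult)
  also have "\<dots> \<le> (1 + a) ^ (2 * ?s)"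
    using exp_half_le[OF a0 a(2)] by (intro power_mono) auto
  finally show ?thesis .
qed

theorem corollary1:
  fixes K :: "(real ^ 'n::finite) set" and f :: "'n rpoly"
  assumes "K \<noteq> {}" and "compact K" and "connected K"
    and "\<exists>\<epsilon>>0. \<exists>\<eta>>0. \<exists>N::real. N \<ge> real CARD('n) \<and>
           (\<forall>x\<in>K. \<forall>\<delta>. 0 < \<delta> \<and> \<delta> \<le> \<epsilon> \<longrightarrow>
              measure lebesgue (K \<inter> cball x \<delta>)
                \<ge> \<eta> * \<delta> powr N * measure lebesgue (cball (0 :: real ^ 'n) 1))"
  shows "(\<lambda>r. upper_bound K f r - min_value K f) \<in> O(\<lambda>r. (ln (real r))\<^sup>2 / (real r)\<^sup>2)"
proof -
  obtain \<epsilon> \<eta> N :: real where "\<epsilon> > 0" "\<eta> > 0" and N: "N \<ge> real CARD('n)"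
    and "\<forall>x\<in>K. \<forall>\<delta>. 0 < \<delta> \<and> \<delta> \<le> \<epsilon> \<longrightarrow>
              measure lebesgue (K \<inter> cball x \<delta>)
                \<ge> \<eta> * \<delta> powr N * measure lebesgue (cball (0 :: real ^ 'n) 1)"
    using assms(4) by blast
  define \<kappa> where "\<kappa> = \<eta> * measure lebesgue (cball (0 :: real ^ 'n) 1)"
  have "measure lebesgue (cball (0 :: real ^ 'n) 1) > 0"
    by (simp add: content_cball_pos)
  then have \<kappa>: "\<kappa> > 0" using \<open>\<eta> > 0\<close> by (simp add: \<kappa>_def)
  have vol: "\<kappa> * \<delta> powr N \<le> measure lebesgue (K \<inter> cball x \<delta>)"
    if "x \<in> K" "0 < \<delta>" "\<delta> \<le> \<epsilon>" for x \<delta>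
    using \<open>\<forall>x\<in>K. _ x\<close> that by (simp add: \<kappa>_def mult.assoc mult.commute mult.left_commute)
  have N0: "N \<ge> 0" using N by linarith
  obtain x0 where x0: "x0 \<in> K" "min_value K f = peval f x0"
    "\<And>x. x \<in> K \<Longrightarrow> min_value K f \<le> peval f x"
    using min_value_attained[OF assms(2,1)] by blast
  \<comment> \<open>The volume condition at the single point \<open>x0\<close> makes the measure of
    \<open>K\<close> positive.\<close>
  have vK: "measure lebesgue K > 0"
  proof -
    have "0 < \<kappa> * \<epsilon> powr N" using \<kappa> \<open>\<epsilon> > 0\<close> by simp
    also have "\<dots> \<le> measure lebesgue (K \<inter> cball x0 \<epsilon>)"
      using x0(1) \<open>\<epsilon> > 0\<close> by (intro vol) auto
    also have "\<dots> \<le> measure lebesgue K"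
      using assms(2) by (intro measure_mono_fmeasurable)
        (auto intro: lmeasurable_compact compact_Int_closed fmeasurableD)
    finally show ?thesis .
  qed
  obtain b where b: "\<And>x. x \<in> K \<Longrightarrow> \<bar>peval f x\<bar> \<le> b"
    using compact_imp_bounded[OF compact_continuous_image[OF continuous_on_peval assms(2)], of f]
    by (auto simp: bounded_iff)
  \<comment> \<open>The maximum with 1 keeps \<open>W\<close> positive even when \<open>f\<close> is
    constant on \<open>K\<close>.\<close>
  define W where "W = max 1 (b - peval f x0)"
  have W: "W > 0" "\<And>x. x \<in> K \<Longrightarrow> peval f x - peval f x0 \<le> W"
    using b by (fastforce simp: W_def)+
  obtain L0 where L0: "L0-lipschitz_on K (peval f)"
    using ex_lipschitz_on_peval[OF assms(2)] by blast
  \<comment> \<open>Adding 1 makes the Lipschitz constant strictly positive, since it will be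
    divided by.\<close>
  define L where "L = L0 + 1"
  have L: "L > 0" "peval f x - peval f x0 \<le> L * dist x x0" if "x \<in> K" for x
    using lipschitz_onD[OF L0 that x0(1)] lipschitz_on_nonneg[OF L0] zero_le_dist[of x x0]
    unfolding L_def dist_real_def distrib_right by linarith+
  \<comment> \<open>A constant \<open>f\<close> has degree 0, whereas \<open>d\<close> has to be
    positive to serve as a divisor of \<open>r\<close>.\<close>
  define d where "d = max 1 (total_degree f)"
  define c where "c = 2 * real d * (2 * N + 2)"
  define a where "a r = c * ln (real r) / real r" for r :: nat
  \<comment> \<open>The radius will be at least W / (2 L r^2), so the volume bound becomes
    \<open>\<kappa>'\<close> times r^(-2N).\<close>
  define \<kappa>' where "\<kappa>' = \<kappa> * (W / (2 * L)) powr N"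
  define C where "C = c\<^sup>2 * W + 4 * W * measure lebesgue K / \<kappa>'"
  have Lpos: "L > 0" using L(1)[OF x0(1)] .
  have \<kappa>': "\<kappa>' > 0" using \<kappa> W(1) Lpos by (simp add: \<kappa>'_def)
  have d1: "d \<ge> 1" by (simp add: d_def)
  have c1: "c \<ge> 1"
  proof -
    have "1 * 1 \<le> (2 * real d) * (2 * N + 2)"
      using d1 N0 by (intro mult_mono) auto
    then show ?thesis by (simp add: c_def)
  qed
  have lim: "a \<longlonglongrightarrow> 0"
    using tendsto_mult[OF tendsto_const[of c] lim_ln_over_n] by (simp add: a_def[abs_def])
  then have "(\<lambda>r. (a r)\<^sup>2 * W / (2 * L)) \<longlonglongrightarrow> 0\<^sup>2 * W / (2 * L)"
    using Lpos by (intro tendsto_intros) auto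
  then have "\<forall>\<^sub>F r in sequentially. (a r)\<^sup>2 * W / (2 * L) < \<epsilon>"
    using \<open>\<epsilon> > 0\<close> by (intro order_tendstoD(2)) auto
  moreover have "\<forall>\<^sub>F r in sequentially. a r < 1"
    using lim by (intro order_tendstoD(2)) auto
  moreover have "\<forall>\<^sub>F r in sequentially. 1 \<le> ln (real r)"
    using filterlim_compose[OF ln_at_top filterlim_real_sequentially]
    by (simp add: filterlim_at_top)
  moreover have "\<forall>\<^sub>F r in sequentially. 2 * d \<le> r"
    by (rule eventually_ge_at_top)
  ultimately have "\<forall>\<^sub>F r in sequentially.
      norm (upper_bound K f r - min_value K f) \<le> C * norm ((ln (real r))\<^sup>2 / (real r)\<^sup>2)"
  proof eventually_elim
    case (elim r)
    define \<delta> where "\<delta> = (a r)\<^sup>2 * W / (2 * L)"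
    have r: "1 \<le> real r" using elim(4) d1 by simp
    \<comment> \<open>Both \<open>c\<close> and ln r are at least 1; dropping the logarithm turns
      the volume bound into a pure power of \<open>r\<close>.\<close>
    have ar: "1 / r \<le> a r"
    proof -
      have "1 * 1 \<le> c * ln (real r)" using c1 elim(3) by (intro mult_mono) auto
      then show ?thesis using r by (simp add: a_def divide_right_mono)
    qed
    then have a0: "0 < a r" using r by (smt (verit) zero_less_divide_1_iff)
    then have \<delta>: "0 < \<delta>" "\<delta> \<le> \<epsilon>" using W(1) Lpos elim(1) by (simp_all add: \<delta>_def)
    have "(1 / r)\<^sup>2 * (W / (2 * L)) \<le> (a r)\<^sup>2 * (W / (2 * L))"
      using ar W(1) Lpos by (intro mult_right_mono power_mono) auto
    then have "W / (2 * L) * real r powr (- 2) \<le> \<delta>"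
      using r by (simp add: \<delta>_def powr_minus field_simps)
    then have "(W / (2 * L) * real r powr (- 2)) powr N \<le> \<delta> powr N"
      using W(1) Lpos N0 by (intro powr_mono2) auto
    moreover have "(W / (2 * L) * real r powr (- 2)) powr N = (W / (2 * L)) powr N * real r powr (- 2 * N)"
      using W(1) Lpos by (subst powr_mult) (simp_all add: powr_powr)
    ultimately have "(W / (2 * L)) powr N * real r powr (- 2 * N) \<le> \<delta> powr N"
      by simp
    then have "\<kappa>' * real r powr (- 2 * N) \<le> \<kappa> * \<delta> powr N"
      using \<kappa> by (simp add: \<kappa>'_def mult.assoc)
    moreover have "real r powr (2 * N + 2) \<le> (1 + a r) ^ (2 * (r div d))"
      using elim d1 N0 by (intro needle_growth) (auto simp: a_def c_def)
    ultimately have "\<kappa>' * real r powr (- 2 * N) * real r powr (2 * N + 2)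
        \<le> \<kappa> * \<delta> powr N * (1 + a r) ^ (2 * (r div d))"
      by (rule mult_mono) (use \<kappa> in simp_all)
    moreover have "real r powr (- 2 * N) * real r powr (2 * N + 2) = (real r)\<^sup>2"
      using r by (simp flip: powr_add)
    ultimately have vol_ge: "\<kappa>' * (real r)\<^sup>2 \<le> \<kappa> * \<delta> powr N * (1 + a r) ^ (2 * (r div d))"
      by (simp add: mult.assoc)
    have v: "0 < \<kappa> * \<delta> powr N"
      using \<kappa> \<delta>(1) by simp
    then have D: "0 < \<kappa> * \<delta> powr N * (1 + a r) ^ (2 * (r div d))"
      by (rule mult_pos_pos) (use a0 in simp)
    have "r div d * total_degree f \<le> r div d * d"
      by (simp add: d_def)
    also have "\<dots> \<le> r" by simp
    finally have "upper_bound K f r - peval f x0 \<le> (a r)\<^sup>2 * W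
        + 4 * W * measure lebesgue K / (\<kappa> * \<delta> powr N * (1 + a r) ^ (2 * (r div d)))"
      using elim(2) v vol[OF x0(1) \<delta>] x0(3)[unfolded x0(2)]
      by (intro upper_bound_le_cheb[OF assms(2) x0(1) _ W(2,1) L(2) Lpos a0]) (simp_all add: \<delta>_def)
    also have "4 * W * measure lebesgue K / (\<kappa> * \<delta> powr N * (1 + a r) ^ (2 * (r div d)))
        \<le> 4 * W * measure lebesgue K / (\<kappa>' * (real r)\<^sup>2)"
      using W(1) vK by (intro divide_left_mono[OF vol_ge] mult_pos_pos[OF D]) (use \<kappa>' r in simp_all)
    also have "\<dots> = 4 * W * measure lebesgue K / \<kappa>' * (1 / (real r)\<^sup>2)"
      by simp
    \<comment> \<open>Since ln r >= 1, the smaller error of order r^(-2) is absorbed into the target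
      rate.\<close>
    also have "\<dots> \<le> 4 * W * measure lebesgue K / \<kappa>' * ((ln (real r))\<^sup>2 / (real r)\<^sup>2)"
      using elim(3) W(1) vK \<kappa>' by (intro mult_left_mono divide_right_mono one_le_power) simp_all
    also have "(a r)\<^sup>2 * W + \<dots> = C * ((ln (real r))\<^sup>2 / (real r)\<^sup>2)"
      by (simp add: C_def a_def power_mult_distrib power_divide algebra_simps)
    finally have "upper_bound K f r - min_value K f \<le> C * ((ln (real r))\<^sup>2 / (real r)\<^sup>2)"
      by (simp add: x0(2))
    then show ?case
      using upper_bound_ge_min_value[OF assms(2) vK, of f r] by simp
  qed
  then show ?thesis
    by (rule bigoI)
qed

end
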